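(* Let $\mathbb{K}$ be a field of characteristic $0$, $\rho:\mathbb{N}^+\to\mathbb{K}$ any function, and $f(x)\in\mathbb{K}[[x]]$ with $$1+\sum_{n\ge1}\Big(\sum_{F\in F(n)}\prod_{h\in\mathcal{H}(F)}\rho(h)\Big)\frac{x^n}{n!}=f(x).$$ Then for every $n\ge1$ with $[x^{n-1}]f(x)\neq0$, $$\rho(n)=\frac{[x^n]\ln f(x)}{[x^{n-1}]f(x)}.$$
   Context: $F(n)$ is the set of labeled forests on the vertex set $\{1,\dots,n\}$, i.e. sets of rooted labeled trees (children unordered) whose vertex sets partition $\{1,\dots,n\}$. For a vertex $u$ of $F$, the hook length $h_u$ is the number of descendants of $u$ (counting $u$ itself), and $\mathcal{H}(F)$ is the multiset of hook lengths of all vertices; the product is over all vertices. Since $f(0)=1$, $\ln f(x)$ is the formal logarithm $\sum_{m\ge1}(-1)^{m-1}(f(x)-1)^m/m$. $[x^n]g(x)$ is the (ordinary) coefficient of $x^n$. *)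

theory Defs
  imports
    "HOL-Library.FSet"
    "HOL-Library.Multiset"
    "HOL-Library.Disjoint_Sets"
    "HOL-Computational_Algebra.Formal_Power_Series"
begin

datatype (vertices: 'a) rtree = Node (root: 'a) (children: "'a rtree fset")

text \<open>
  The datatype allows a label to be repeated. In a labeled tree every label names exactly one
  vertex. Siblings then have disjoint nonempty vertex sets, so collecting the children in a set
  (rather than a multiset) identifies nothing.
\<close>

inductive labeled_tree :: "'a rtree \<Rightarrow> bool" where
  "\<lbrakk>\<forall>t \<in> fset ts. labeled_tree t; \<forall>t \<in> fset ts. v \<notin> vertices t;
    disjoint_family_on vertices (fset ts)\<rbrakk> \<Longrightarrow> labeled_tree (Node v ts)"

definition labeled_forests :: "nat \<Rightarrow> nat rtree set set" where
  "labeled_forests n =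
     {F. (\<forall>t \<in> F. labeled_tree t) \<and> disjoint_family_on vertices F \<and>
         (\<Union>t\<in>F. vertices t) = {1..n}}"

text \<open>The full subtrees of a tree: one for each vertex, consisting of it and everything below it.\<close>

primrec subtrees :: "'a rtree \<Rightarrow> 'a rtree set" where
  "subtrees (Node v ts) = insert (Node v ts) (\<Union>(fset (subtrees |`| ts)))"

definition descendants :: "'a rtree set \<Rightarrow> 'a \<Rightarrow> 'a set" where
  "descendants F u = (\<Union>s \<in> {s \<in> (\<Union>t\<in>F. subtrees t). root s = u}. vertices s)"

definition hook_length :: "'a rtree set \<Rightarrow> 'a \<Rightarrow> nat" where
  "hook_length F u = card (descendants F u)"

definition hook_lengths :: "'a rtree set \<Rightarrow> nat multiset" where
  "hook_lengths F = image_mset (hook_length F) (mset_set (\<Union>t\<in>F. vertices t))"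

text \<open>
  The formal logarithm of a power series with constant coefficient 1: the library's
  \<^term>\<open>fps_ln 1\<close> is the series of \<open>ln (1 + x)\<close>, composed here with \<open>f - 1\<close>.
\<close>

definition formal_ln :: "'a::field_char_0 fps \<Rightarrow> 'a fps" where
  "formal_ln f = fps_ln 1 oo (f - 1)"

end

theory Submission
  imports Defs
begin

text \<open>
  Let \<open>a n\<close> be the total weight of the forests on \<open>n\<close> labels. Deleting the root of a tree on
  \<open>n\<close> labels leaves a forest, and the root contributes the factor \<open>\<rho> n\<close>, so the trees on \<open>n\<close>
  labels have total weight \<open>t n = n \<rho>(n) a(n - 1)\<close>. Splitting off the tree that contains a fixed label
  gives \<open>a(n + 1) = \<Sum>k\<le>n. (n choose k) t(k + 1) a(n - k)\<close>. For the exponential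
  generating functions this says \<open>f' = T' f\<close>, hence \<open>T = ln f\<close>, and comparing coefficients gives the claim.
\<close>

subsection \<open>Decomposition of forests\<close>

text \<open>An arbitrary label set takes the place of \<open>{1..n}\<close>, because removing a root
  or a whole tree leaves labels that are no longer an initial segment.\<close>

definition forests :: "'a set \<Rightarrow> 'a rtree set set" where
  "forests V =
     {F. (\<forall>t \<in> F. labeled_tree t) \<and> disjoint_family_on vertices F \<and> (\<Union>t\<in>F. vertices t) = V}"

definition trees :: "'a set \<Rightarrow> 'a rtree set" where
  "trees V = {t. labeled_tree t \<and> vertices t = V}"

lemma finite_vertices: "finite (vertices t)"
  by (induction t) auto

lemma root_in_vertices: "root t \<in> vertices t"
  by (cases t) auto

lemma vertices_nonempty: "vertices t \<noteq> {}"
  using root_in_vertices by fastforce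

lemma labeled_tree_Node_iff:
  "labeled_tree (Node v ts) \<longleftrightarrow> (\<forall>t \<in> fset ts. labeled_tree t) \<and> (\<forall>t \<in> fset ts. v \<notin> vertices t) \<and>
     disjoint_family_on vertices (fset ts)"
  by (subst labeled_tree.simps) auto

text \<open>Disjoint nonempty vertex sets are distinct, so a forest embeds into the power set of its
  labels.\<close>

lemma finite_forest:
  assumes "F \<in> forests V" "finite V"
  shows "finite F"
proof (rule inj_on_finite)
  show "inj_on vertices F"
    using assms(1) vertices_nonempty unfolding forests_def disjoint_family_on_def inj_on_def
    by fastforce
  show "vertices ` F \<subseteq> Pow V"
    using assms(1) unfolding forests_def by auto
qed (use assms in simp)

text \<open>A tree is the same as a root together with a forest on the remaining labels. Finiteness
  of \<open>V\<close> makes every such forest finite, which is what lets \<open>Abs_fset\<close>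
  invert \<open>fset\<close>.\<close>

lemma bij_betw_Node_forests_trees:
  assumes "finite V"
  shows "bij_betw (\<lambda>(v, F). Node v (Abs_fset F)) (SIGMA v:V. forests (V - {v})) (trees V)"
proof (rule bij_betwI[where g = "\<lambda>t. (root t, fset (children t))"])
  have fin: "finite F" if "F \<in> forests (V - {v})" for F v
    using finite_forest that assms by blast
  show "(\<lambda>(v, F). Node v (Abs_fset F)) \<in> (SIGMA v:V. forests (V - {v})) \<rightarrow> trees V"
  proof clarify
    fix v F assume v: "v \<in> V" and F: "F \<in> forests (V - {v})"
    have "fset (Abs_fset F) = F"
      using fin[OF F] by (simp add: Abs_fset_inverse)
    moreover have "insert v (\<Union>t\<in>F. vertices t) = V" "\<forall>t\<in>F. v \<notin> vertices t"
      using v F unfolding forests_def by blast+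
    ultimately show "Node v (Abs_fset F) \<in> trees V"
      using F by (simp add: trees_def labeled_tree_Node_iff forests_def)
  qed
  show "(\<lambda>t. (root t, fset (children t))) \<in> trees V \<rightarrow> (SIGMA v:V. forests (V - {v}))"
  proof
    fix t assume "t \<in> trees V"
    then show "(root t, fset (children t)) \<in> (SIGMA v:V. forests (V - {v}))"
      by (cases t) (auto simp: trees_def labeled_tree_Node_iff forests_def)
  qed
  show "(\<lambda>t. (root t, fset (children t))) ((\<lambda>(v, F). Node v (Abs_fset F)) p) = p"
    if "p \<in> (SIGMA v:V. forests (V - {v}))" for p
    using that fin by (auto simp: Abs_fset_inverse)
  show "(\<lambda>(v, F). Node v (Abs_fset F)) (root t, fset (children t)) = t" for t :: "'a rtree"
    by (cases t) (simp add: fset_inverse)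
qed

lemma insert_tree_forest:
  assumes "U \<subseteq> V" "t \<in> trees U" "F \<in> forests (V - U)"
  shows "insert t F \<in> forests V"
proof -
  have "disjoint_family_on vertices (insert t F)"
    using assms unfolding forests_def trees_def disjoint_family_on_def by (auto; blast)
  then show ?thesis
    using assms unfolding forests_def trees_def by auto
qed

lemma remove_tree_forest:
  assumes "F \<in> forests V" "t \<in> F"
  shows "t \<in> trees (vertices t)" "F - {t} \<in> forests (V - vertices t)" "vertices t \<subseteq> V"
proof -
  have disj: "vertices s \<inter> vertices t = {}" if "s \<in> F - {t}" for s
    using assms that unfolding forests_def disjoint_family_on_def by blast
  show "t \<in> trees (vertices t)" "vertices t \<subseteq> V"
    using assms unfolding forests_def trees_def by auto
  have "(\<Union>s\<in>F - {t}. vertices s) = V - vertices t"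
    using assms disj unfolding forests_def by blast
  then show "F - {t} \<in> forests (V - vertices t)"
    using assms unfolding forests_def disjoint_family_on_def by auto
qed

text \<open>Exactly one tree of a forest on \<open>V\<close> contains the marked label
  \<open>x\<close>. Its vertex set is \<open>U\<close>, and the other trees form a forest on
  \<open>V - U\<close>. Marking \<open>x\<close> makes the splitting unique.\<close>

lemma bij_betw_insert_tree_forest:
  assumes "x \<in> V"
  shows "bij_betw (\<lambda>(U, t, F). insert t F)
           (SIGMA U:{U. x \<in> U \<and> U \<subseteq> V}. trees U \<times> forests (V - U)) (forests V)"
    (is "bij_betw ?f ?A _")
proof (rule bij_betw_imageI)
  have notin: "t \<notin> F" "\<forall>s\<in>F. x \<notin> vertices s" "x \<in> vertices t"
    if "t \<in> trees U" "F \<in> forests (V - U)" "x \<in> U" for t F U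
    using that by (auto simp: forests_def trees_def)
  show "inj_on ?f ?A"
  proof (rule inj_onI, clarify)
    fix U t F U' t' F'
    assume A: "x \<in> U" "t \<in> trees U" "F \<in> forests (V - U)"
      "x \<in> U'" "t' \<in> trees U'" "F' \<in> forests (V - U')" and eq: "insert t F = insert t' F'"
    have "t = t'"
      \<comment> \<open>Both \<open>t\<close> and \<open>t'\<close> are the only member of the
        common forest whose vertices include \<open>x\<close>.\<close>
      using eq notin[OF A(2,3,1)] notin[OF A(5,6,4)] by blast
    moreover have "F = F'"
      using eq \<open>t = t'\<close> notin(1)[OF A(2,3,1)] notin(1)[OF A(5,6,4)] by (simp add: insert_ident)
    moreover have "U = U'"
      using A \<open>t = t'\<close> by (auto simp: trees_def)
    ultimately show "U = U' \<and> (t, F) = (t', F')" by simp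
  qed
  show "?f ` ?A = forests V"
  proof
    show "?f ` ?A \<subseteq> forests V"
      using insert_tree_forest by auto
    show "forests V \<subseteq> ?f ` ?A"
    proof
      fix F assume F: "F \<in> forests V"
      then obtain t where t: "t \<in> F" "x \<in> vertices t"
        using assms unfolding forests_def by blast
      have "(vertices t, t, F - {t}) \<in> ?A"
        using remove_tree_forest[OF F t(1)] t by auto
      moreover have "F = ?f (vertices t, t, F - {t})"
        using t by auto
      ultimately show "F \<in> ?f ` ?A" by (rule rev_image_eqI)
    qed
  qed
qed

lemma forests_empty: "forests {} = {{}}"
  by (auto simp: forests_def disjoint_family_on_def vertices_nonempty)

text \<open>Finiteness of the smaller forest sets is a hypothesis so that the lemma can serve inside
  the induction that proves it.\<close>

lemma finite_trees_if_finite_forests: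
  assumes "finite V" "\<And>v. v \<in> V \<Longrightarrow> finite (forests (V - {v}))"
  shows "finite (trees V)"
  using bij_betw_finite[OF bij_betw_Node_forests_trees[OF assms(1)]] assms by auto

lemma finite_forests: "finite V \<Longrightarrow> finite (forests V)"
proof (induction V rule: finite_psubset_induct)
  case (psubset V)
  show ?case
  proof (cases "V = {}")
    case False
    then obtain x where x: "x \<in> V" by blast
    \<comment> \<open>\<open>U\<close> may be all of \<open>V\<close>, but trees on \<open>U\<close>
      reduce to forests on \<open>U - {v}\<close>, a proper subset of \<open>V\<close>;
      \<open>V - U\<close> is proper because it misses \<open>x\<close>.\<close>
    have "finite (trees U \<times> forests (V - U))" if "x \<in> U" "U \<subseteq> V" for U
    proof -
      have "finite (forests (U - {v}))" if "v \<in> U" for v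
        using that \<open>U \<subseteq> V\<close> by (intro psubset.IH) auto
      moreover have "finite (forests (V - U))"
        using x that by (intro psubset.IH) auto
      moreover have "finite U"
        using that psubset.hyps finite_subset by blast
      ultimately show ?thesis
        using finite_trees_if_finite_forests by blast
    qed
    then have "finite (SIGMA U:{U. x \<in> U \<and> U \<subseteq> V}. trees U \<times> forests (V - U))"
      using psubset.hyps by - (rule finite_SigmaI, auto)
    then show ?thesis
      using bij_betw_finite[OF bij_betw_insert_tree_forest[OF x]] by blast
  qed (simp add: forests_empty)
qed

lemma finite_trees: "finite V \<Longrightarrow> finite (trees V)"
  by (simp add: finite_trees_if_finite_forests finite_forests)

subsection \<open>Hook weights\<close>

text \<open>Indexing the product by vertices instead of by a multiset lets it split along disjoint
  vertex sets.\<close>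

definition hook_weight :: "(nat \<Rightarrow> 'k::comm_monoid_mult) \<Rightarrow> 'a rtree set \<Rightarrow> 'k" where
  "hook_weight \<rho> F = (\<Prod>u\<in>(\<Union>t\<in>F. vertices t). \<rho> (hook_length F u))"

lemma prod_mset_hook_lengths: "(\<Prod>h\<in>#hook_lengths F. \<rho> h) = hook_weight \<rho> F"
  by (simp add: hook_lengths_def hook_weight_def prod_unfold_prod_mset multiset.map_comp o_def)

lemma vertices_subtree: "s \<in> subtrees t \<Longrightarrow> vertices s \<subseteq> vertices t"
proof (induction t)
  case (Node v ts)
  show ?case
  proof (cases "s = Node v ts")
    case False
    then obtain c where "c \<in> fset ts" "s \<in> subtrees c"
      using Node.prems by auto
    then show ?thesis
      using Node.IH[of c] by auto
  qed simp
qed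

lemma root_subtree_in_vertices: "s \<in> subtrees t \<Longrightarrow> root s \<in> vertices t"
  using vertices_subtree root_in_vertices by blast

text \<open>Every subtree of a tree in \<open>G\<close> has its root among the vertices of
  \<open>G\<close>, so none of them is rooted at \<open>u\<close>.\<close>

lemma descendants_Un_left:
  assumes "u \<notin> (\<Union>t\<in>G. vertices t)"
  shows "descendants (F \<union> G) u = descendants F u"
proof -
  have "root s \<noteq> u" if "t \<in> G" "s \<in> subtrees t" for s t
    using assms that root_subtree_in_vertices[OF that(2)] by blast
  then have "{s \<in> (\<Union>t\<in>F \<union> G. subtrees t). root s = u} = {s \<in> (\<Union>t\<in>F. subtrees t). root s = u}"
    by blast
  then show ?thesis
    by (simp only: descendants_def)
qed

lemma descendants_root: "descendants {Node v ts} v = vertices (Node v ts)"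
proof
  show "descendants {Node v ts} v \<subseteq> vertices (Node v ts)"
    using vertices_subtree[of _ "Node v ts"] unfolding descendants_def by blast
  show "vertices (Node v ts) \<subseteq> descendants {Node v ts} v"
    unfolding descendants_def by (rule UN_upper) simp
qed

lemma descendants_below_root: "u \<noteq> v \<Longrightarrow> descendants {Node v ts} u = descendants (fset ts) u"
  unfolding descendants_def by auto

text \<open>All vertices descend from the root, and putting a root on top of a forest changes no
  hook length below it.\<close>

lemma hook_weight_Node:
  assumes "labeled_tree (Node v ts)"
  shows "hook_weight \<rho> {Node v ts} = \<rho> (card (vertices (Node v ts))) * hook_weight \<rho> (fset ts)"
proof -
  let ?W = "\<Union>t\<in>fset ts. vertices t"
  have v: "v \<notin> ?W" using assms by (auto simp: labeled_tree_Node_iff)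
  have "hook_weight \<rho> {Node v ts} = (\<Prod>u\<in>insert v ?W. \<rho> (hook_length {Node v ts} u))"
    by (simp add: hook_weight_def)
  also have "\<dots> = \<rho> (hook_length {Node v ts} v) * (\<Prod>u\<in>?W. \<rho> (hook_length {Node v ts} u))"
    using v finite_vertices by (intro prod.insert) auto
  also have "(\<Prod>u\<in>?W. \<rho> (hook_length {Node v ts} u)) = hook_weight \<rho> (fset ts)"
    unfolding hook_weight_def hook_length_def
    using v by (intro prod.cong refl) (metis descendants_below_root)
  finally show ?thesis
    by (simp only: hook_length_def descendants_root)
qed

text \<open>Hook lengths in one tree are unaffected by the others, so the product splits over
  \<open>U\<close> and \<open>V - U\<close>.\<close>

lemma hook_weight_insert:
  assumes "U \<subseteq> V" "finite V" "t \<in> trees U" "F \<in> forests (V - U)"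
  shows "hook_weight \<rho> (insert t F) = hook_weight \<rho> {t} * hook_weight \<rho> F"
proof -
  have UF: "vertices t = U" "(\<Union>s\<in>F. vertices s) = V - U"
    using assms by (auto simp: trees_def forests_def)
  have "hook_weight \<rho> (insert t F) = (\<Prod>u\<in>U \<union> (V - U). \<rho> (hook_length (insert t F) u))"
    by (simp add: hook_weight_def UF)
  also have "\<dots> = (\<Prod>u\<in>U. \<rho> (hook_length (insert t F) u)) *
      (\<Prod>u\<in>V - U. \<rho> (hook_length (insert t F) u))"
    using assms by (intro prod.union_disjoint) (auto intro: finite_subset)
  also have "(\<Prod>u\<in>U. \<rho> (hook_length (insert t F) u)) = hook_weight \<rho> {t}"
    unfolding hook_weight_def hook_length_def
    using descendants_Un_left[of _ F "{t}"] UF by (intro prod.cong) auto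
  also have "(\<Prod>u\<in>V - U. \<rho> (hook_length (insert t F) u)) = hook_weight \<rho> F"
    unfolding hook_weight_def hook_length_def
    using descendants_Un_left[of _ "{t}" F] UF by (intro prod.cong) auto
  finally show ?thesis .
qed

subsection \<open>Total weights\<close>

definition forest_sum :: "(nat \<Rightarrow> 'k::comm_semiring_1) \<Rightarrow> 'a set \<Rightarrow> 'k" where
  "forest_sum \<rho> V = (\<Sum>F\<in>forests V. hook_weight \<rho> F)"

definition tree_sum :: "(nat \<Rightarrow> 'k::comm_semiring_1) \<Rightarrow> 'a set \<Rightarrow> 'k" where
  "tree_sum \<rho> V = (\<Sum>t\<in>trees V. hook_weight \<rho> {t})"

text \<open>The root's hook length is \<open>card V\<close> for every tree on \<open>V\<close>, so
  its factor comes out of the sum. The sum over \<open>v\<close> collapses to a multiple only once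
  forest sums are known to depend on cardinality alone.\<close>

lemma tree_sum_eq:
  assumes "finite V"
  shows "tree_sum \<rho> V = \<rho> (card V) * (\<Sum>v\<in>V. forest_sum \<rho> (V - {v}))"
proof -
  have "hook_weight \<rho> {Node v (Abs_fset F)} = \<rho> (card V) * hook_weight \<rho> F"
    if "v \<in> V" "F \<in> forests (V - {v})" for v F
  proof -
    have "Node v (Abs_fset F) \<in> trees V"
      using bij_betwE[OF bij_betw_Node_forests_trees[OF assms]] that by auto
    moreover have "fset (Abs_fset F) = F"
      using finite_forest[OF that(2)] assms by (simp add: Abs_fset_inverse)
    ultimately show ?thesis
      using hook_weight_Node[of v "Abs_fset F" \<rho>] unfolding trees_def by auto
  qed
  then have "tree_sum \<rho> V =
      (\<Sum>(v, F)\<in>(SIGMA v:V. forests (V - {v})). \<rho> (card V) * hook_weight \<rho> F)"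
    unfolding tree_sum_def
    by (subst sum.reindex_bij_betw[OF bij_betw_Node_forests_trees[OF assms], symmetric])
      (auto intro!: sum.cong)
  also have "\<dots> = (\<Sum>v\<in>V. \<Sum>F\<in>forests (V - {v}). \<rho> (card V) * hook_weight \<rho> F)"
    using assms by (intro sum.Sigma[symmetric]) (auto intro: finite_forests)
  finally show ?thesis
    by (simp add: forest_sum_def sum_distrib_left)
qed

lemma forest_sum_eq:
  assumes "finite V" "x \<in> V"
  shows "forest_sum \<rho> V = (\<Sum>U | x \<in> U \<and> U \<subseteq> V. tree_sum \<rho> U * forest_sum \<rho> (V - U))"
proof -
  let ?A = "SIGMA U:{U. x \<in> U \<and> U \<subseteq> V}. trees U \<times> forests (V - U)"
  have "forest_sum \<rho> V = (\<Sum>(U, t, F)\<in>?A. hook_weight \<rho> {t} * hook_weight \<rho> F)"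
    unfolding forest_sum_def
    by (subst sum.reindex_bij_betw[OF bij_betw_insert_tree_forest[OF assms(2)], symmetric])
      (auto intro!: sum.cong intro: hook_weight_insert[OF _ assms(1)])
  also have "\<dots> = (\<Sum>U | x \<in> U \<and> U \<subseteq> V. \<Sum>(t, F)\<in>trees U \<times> forests (V - U).
      hook_weight \<rho> {t} * hook_weight \<rho> F)"
    using assms
    by (intro sum.Sigma[symmetric])
      (auto intro!: finite_trees finite_forests intro: finite_subset)
  finally show ?thesis
    by (simp add: forest_sum_def tree_sum_def sum_product sum.cartesian_product)
qed

lemma sum_card_Pow:
  fixes g :: "nat \<Rightarrow> 'b::semiring_1"
  assumes "finite A"
  shows "(\<Sum>B\<in>Pow A. g (card B)) = (\<Sum>k\<le>card A. of_nat (card A choose k) * g k)"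
proof -
  have "(\<Sum>B\<in>Pow A. g (card B)) = (\<Sum>k\<le>card A. \<Sum>B | B \<in> Pow A \<and> card B = k. g (card B))"
    using assms by (intro sum.group[symmetric]) (auto intro: card_mono)
  also have "\<dots> = (\<Sum>k\<le>card A. of_nat (card {B. B \<subseteq> A \<and> card B = k}) * g k)"
    by (intro sum.cong refl) simp
  finally show ?thesis
    using assms by (simp add: n_subsets)
qed

text \<open>The factor \<open>\<rho> (Suc k) * (of_nat (Suc k) * forest_total \<rho> k)\<close> is
  the total weight of the trees on \<open>k + 1\<close> labels, with \<open>k + 1\<close> choices of
  root. The binomial coefficient counts the \<open>k\<close> labels that join the marked one in its
  tree.\<close>

fun forest_total :: "(nat \<Rightarrow> 'k::comm_semiring_1) \<Rightarrow> nat \<Rightarrow> 'k" where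
  "forest_total \<rho> 0 = 1"
| "forest_total \<rho> (Suc n) = (\<Sum>k\<le>n. of_nat (n choose k) *
     (\<rho> (Suc k) * (of_nat (Suc k) * forest_total \<rho> k) * forest_total \<rho> (n - k)))"

lemma forest_sum_eq_forest_total:
  "finite V \<Longrightarrow> forest_sum \<rho> V = forest_total \<rho> (card V)"
proof (induction V rule: finite_psubset_induct)
  case (psubset V)
  show ?case
  proof (cases "V = {}")
    case True
    then show ?thesis by (simp add: forest_sum_def forests_empty hook_weight_def)
  next
    case False
    then obtain x where x: "x \<in> V" by blast
    define A where "A = V - {x}"
    have V: "V = insert x A" and A: "x \<notin> A" "finite A"
      using x psubset.hyps by (auto simp: A_def)
    \<comment> \<open>The contribution of a tree on \<open>x\<close> and \<open>k\<close> further
      labels, together with a forest on the remaining \<open>card A - k\<close> labels.\<close>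
    define g where "g k = \<rho> (Suc k) * (of_nat (Suc k) * forest_total \<rho> k) *
      forest_total \<rho> (card A - k)" for k
    have summand: "tree_sum \<rho> (insert x B) * forest_sum \<rho> (V - insert x B) = g (card B)"
      if "B \<subseteq> A" for B
    proof -
      have B: "finite B" "x \<notin> B"
        using that A finite_subset by blast+
      have "forest_sum \<rho> (insert x B - {v}) = forest_total \<rho> (card B)" if "v \<in> insert x B" for v
      proof -
        \<comment> \<open>Deleting \<open>v\<close> leaves a proper subset of \<open>V\<close> even
          when \<open>insert x B\<close> is all of \<open>V\<close>, so the induction hypothesis
          applies.\<close>
        have "forest_sum \<rho> (insert x B - {v}) = forest_total \<rho> (card (insert x B - {v}))"
          using that \<open>B \<subseteq> A\<close> V by (intro psubset.IH) auto
        also have "card (insert x B - {v}) = card B"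
          using that B by (simp add: card_Diff_singleton)
        finally show ?thesis .
      qed
      then have "tree_sum \<rho> (insert x B) =
          \<rho> (Suc (card B)) * (of_nat (Suc (card B)) * forest_total \<rho> (card B))"
        using B by (simp add: tree_sum_eq del: of_nat_Suc)
      moreover have "forest_sum \<rho> (V - insert x B) = forest_total \<rho> (card (V - insert x B))"
        using V by (intro psubset.IH) auto
      moreover have "card (V - insert x B) = card A - card B"
      proof -
        have "V - insert x B = A - B" using V A B by auto
        then show ?thesis using that B by (simp add: card_Diff_subset)
      qed
      ultimately show ?thesis by (simp add: g_def)
    qed
    have "bij_betw (insert x) (Pow A) {U. x \<in> U \<and> U \<subseteq> V}"
      by (rule bij_betwI[where g = "\<lambda>U. U - {x}"]) (use V A in auto)
    then have "forest_sum \<rho> V =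
        (\<Sum>B\<in>Pow A. tree_sum \<rho> (insert x B) * forest_sum \<rho> (V - insert x B))"
      by (simp add: forest_sum_eq[OF psubset.hyps x] sum.reindex_bij_betw[symmetric])
    also have "\<dots> = (\<Sum>B\<in>Pow A. g (card B))"
      using summand by (intro sum.cong) auto
    also have "\<dots> = forest_total \<rho> (Suc (card A))"
      by (subst sum_card_Pow[OF A(2)]) (simp add: g_def del: of_nat_Suc)
    finally show ?thesis using V A by simp
  qed
qed

lemma forest_total_eq_sum_labeled_forests:
  "(\<Sum>F\<in>labeled_forests n. \<Prod>h\<in>#hook_lengths F. \<rho> h) = forest_total \<rho> n"
  using forest_sum_eq_forest_total[of "{1..n}" \<rho>]
  by (simp add: prod_mset_hook_lengths forest_sum_def labeled_forests_def forests_def)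

subsection \<open>Generating functions\<close>

text \<open>By the chain rule: the derivative of \<open>fps_ln 1\<close> is the inverse of
  \<open>1 + fps_X\<close>, and composing that with \<open>f - 1\<close> gives
  \<open>inverse f\<close>.\<close>

lemma deriv_formal_ln:
  assumes "fps_nth f 0 = 1"
  shows "fps_deriv (formal_ln f) * f = fps_deriv f"
proof -
  have 0: "fps_nth (f - 1) 0 = 0" using assms by simp
  have "fps_deriv (formal_ln f) = (inverse (1 + fps_X) oo (f - 1)) * fps_deriv f"
    by (simp add: formal_ln_def fps_compose_deriv[OF 0] fps_ln_deriv fps_divide_unit)
  also have "inverse (1 + fps_X) oo (f - 1) = inverse f"
    by (subst fps_inverse_compose[OF 0]) (simp_all add: fps_compose_add_distrib fps_X_fps_compose_startby0[OF 0])
  finally show ?thesis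
    using assms inverse_mult_eq_1[of f] by (simp add: mult.commute mult.left_commute)
qed

text \<open>The first factor on the right is the derivative of the exponential generating function
  of trees: its coefficient at \<open>n\<close> is the total tree weight on \<open>n + 1\<close>
  labels divided by \<open>fact n\<close>.\<close>

lemma deriv_forest_egf:
  fixes \<rho> :: "nat \<Rightarrow> 'k::field_char_0"
  defines "f \<equiv> Abs_fps (\<lambda>n. forest_total \<rho> n / fact n)"
  shows "fps_deriv f = Abs_fps (\<lambda>n. of_nat (Suc n) * \<rho> (Suc n) * fps_nth f n) * f"
proof (rule fps_ext)
  fix n
  have "fps_nth (fps_deriv f) n = forest_total \<rho> (Suc n) / fact n"
    by (simp add: f_def divide_simps del: of_nat_Suc forest_total.simps)
  also have "\<dots> = (\<Sum>k\<le>n. of_nat (Suc k) * \<rho> (Suc k) * fps_nth f k * fps_nth f (n - k))"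
    \<comment> \<open>Dividing \<open>n choose k\<close> by \<open>fact n\<close> leaves the two
      factorials that normalize the coefficients of \<open>f\<close> at \<open>k\<close> and
      \<open>n - k\<close>.\<close>
    by (simp add: f_def sum_divide_distrib binomial_fact del: of_nat_Suc) (simp add: mult_ac)
  finally show "fps_nth (fps_deriv f) n =
      fps_nth (Abs_fps (\<lambda>n. of_nat (Suc n) * \<rho> (Suc n) * fps_nth f n) * f) n"
    by (simp add: fps_mult_nth atMost_atLeast0 del: of_nat_Suc)
qed

theorem theorem4p4:
  fixes \<rho> :: "nat \<Rightarrow> 'k::field_char_0" and f :: "'k fps"
  assumes "1 + Abs_fps (\<lambda>n. if n = 0 then 0
             else (\<Sum>F\<in>labeled_forests n. \<Prod>h\<in>#hook_lengths F. \<rho> h) / fact n) = f"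
  shows "\<forall>n\<ge>1. fps_nth f (n - 1) \<noteq> 0 \<longrightarrow> \<rho> n = fps_nth (formal_ln f) n / fps_nth f (n - 1)"
proof (intro allI impI)
  fix n :: nat
  assume n: "1 \<le> n" and nz: "fps_nth f (n - 1) \<noteq> 0"
  obtain m where m: "n = Suc m" using n by (cases n) auto
  \<comment> \<open>The separate summand 1 agrees with \<open>forest_total \<rho> 0 = 1\<close>, so
    a single formula covers all coefficients.\<close>
  have f: "f = Abs_fps (\<lambda>n. forest_total \<rho> n / fact n)"
    unfolding assms[symmetric] forest_total_eq_sum_labeled_forests
    by (rule fps_ext) simp
  have f0: "fps_nth f 0 = 1" by (simp add: f)
  then have "f \<noteq> 0" by auto
  have "fps_deriv (formal_ln f) * f =
      Abs_fps (\<lambda>n. of_nat (Suc n) * \<rho> (Suc n) * fps_nth f n) * f"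
    using deriv_formal_ln[OF f0] deriv_forest_egf[of \<rho>] by (simp only: f)
  \<comment> \<open>Power series over a field have no zero divisors, so \<open>f\<close>
    cancels.\<close>
  then have "fps_deriv (formal_ln f) = Abs_fps (\<lambda>n. of_nat (Suc n) * \<rho> (Suc n) * fps_nth f n)"
    using \<open>f \<noteq> 0\<close> by (metis mult_right_cancel)
  then have "of_nat (Suc m) * fps_nth (formal_ln f) (Suc m) =
      of_nat (Suc m) * \<rho> (Suc m) * fps_nth f m"
    by (auto dest!: arg_cong[where f = "\<lambda>g. fps_nth g m"] simp del: of_nat_Suc)
  \<comment> \<open>Characteristic 0 makes \<open>of_nat (Suc m)\<close> nonzero, hence
    cancellable.\<close>
  then have "fps_nth (formal_ln f) (Suc m) = \<rho> (Suc m) * fps_nth f m"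
    by (simp add: mult.assoc del: of_nat_Suc)
  then show "\<rho> n = fps_nth (formal_ln f) n / fps_nth f (n - 1)"
    using nz m by simp
qed

end
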